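(* For every fixed $n\in\mathbb{N}$, the best constant $c_n(\alpha)$ in the Markov inequality $\|p'\|_{w_\alpha}\le c_n(\alpha)\|p\|_{w_\alpha}$, $p\in\mathcal{P}_n$, satisfies: (i) $\displaystyle \lim_{\alpha\to -1^+}(\alpha+1)\,c_n(\alpha)^2=\frac{n(n+1)}{2}$; (ii) $\displaystyle \frac{2n}{3}\le \lim_{\alpha\to\infty}\alpha\, c_n(\alpha)^2\le 3(n+1)$.
   Context: For real $\alpha>-1$ let $w_\alpha(t)=t^\alpha e^{-t}$, $t>0$, be the Laguerre weight and $\|f\|_{w_\alpha}=\left(\int_0^\infty |f(x)|^2 w_\alpha(x)\,dx\right)^{1/2}$. $\mathcal{P}_n$ is the set of algebraic polynomials (real coefficients) of degree at most $n$. The best Markov constant is $c_n(\alpha)=\sup_{p\in\mathcal{P}_n,\,p\ne 0}\|p'\|_{w_\alpha}/\|p\|_{w_\alpha}$. *)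

theory Defs
  imports "HOL-Analysis.Analysis" "HOL-Computational_Algebra.Polynomial"
begin

definition laguerre_weight :: "real \<Rightarrow> real \<Rightarrow> real" where
  "laguerre_weight \<alpha> t = t powr \<alpha> * exp (- t)"

definition laguerre_norm :: "real \<Rightarrow> (real \<Rightarrow> real) \<Rightarrow> real" where
  "laguerre_norm \<alpha> f = sqrt (LBINT x:{0<..}. \<bar>f x\<bar>\<^sup>2 * laguerre_weight \<alpha> x)"

definition polys_upto :: "nat \<Rightarrow> real poly set" where
  "polys_upto n = {p. degree p \<le> n}"

(* The supremum is taken in the reals. For \<alpha> > -1 the set of quotients is nonempty and
   bounded above, because the polynomials of degree at most n form a finite-dimensional
   space on which the weighted norm is a genuine norm. For \<alpha> \<le> -1 the value has no meaning. *)
definition markov_const :: "nat \<Rightarrow> real \<Rightarrow> real" where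
  "markov_const n \<alpha> =
     (SUP p \<in> polys_upto n - {0}.
        laguerre_norm \<alpha> (poly (pderiv p)) / laguerre_norm \<alpha> (poly p))"

end

theory Submission
  imports Defs
begin

text \<open>
  Everything becomes explicit in the Laguerre polynomials $L_k$ of parameter \<open>\<alpha>\<close>, which are
  orthogonal for the weight, with squared norms $h_k = \Gamma(\alpha+k+1)/k!$, and satisfy
  $L_k' = -\sum_{j<k} L_j$. For $p = \sum_{k\le n} a_k L_k$ this gives
  \[ \|p\|^2 = \sum_{k\le n} h_k a_k^2, \qquad
     \|p'\|^2 = \sum_{j<n} h_j S_j^2, \qquad S_j = \sum_{j<k\le n} a_k, \]
  so that $c_n(\alpha)^2$ is the largest ratio of two quadratic forms in $(a_0,\dots,a_n)$ whose
  coefficients are, up to the common factor $h_0$, determined by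
  $h_{k+1} = h_k (\alpha+k+1)/(k+1)$.

  As $\alpha\to-1$, $h_0$ dominates: $h_k/h_0 \sim (\alpha+1)/k$ for $k\ge1$. Hence
  $\|p'\|^2 \approx h_0 S_0^2$, and Cauchy-Schwarz gives
  $S_0^2 \le \sum_{k\le n} k \cdot \sum_{1\le k\le n} a_k^2/k$, with equality for
  $a_k = k$. This is the limit $n(n+1)/2$; the exact inequality $k h_k \ge (\alpha+1) h_0$ makes the upper bound
  rigorous (\<open>deriv_form_le_near_minus_1\<close>), and the coefficients $a_k = k$ give the lower
  bound.

  As $\alpha\to\infty$, consecutive $h_j$ differ by a large factor: $h_j \le r^2 h_{j+1}$ for
  $j<n$, where $r^2 = n/\alpha$. Since $S_j = a_{j+1} + S_{j+1}$, the triangle inequality in the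
  weighted $\ell^2$ norm yields $\|p'\| \le r\|p\| + r\|p'\|$, so
  $c_n(\alpha) \le r/(1-r)$ for $\alpha > n$ (\<open>deriv_form_le_large\<close>), while $p = L_n$ gives
  $c_n(\alpha)^2 \ge h_{n-1}/h_n = n/(\alpha+n)$. Thus $\alpha c_n(\alpha)^2$ tends to exactly $n$,
  which lies between $2n/3$ and $3(n+1)$. (As $\alpha\to\infty$ the rescaled weight becomes Gaussian,
  and $n$ is the sharp constant for Hermite polynomials.)
\<close>

section \<open>Integration of polynomials against the Laguerre weight\<close>

definition laguerre_integral :: "real \<Rightarrow> real poly \<Rightarrow> real" where
  "laguerre_integral \<alpha> p = (LBINT x:{0<..}. poly p x * laguerre_weight \<alpha> x)"

lemma laguerre_weight_moment:
  assumes "\<alpha> > -1"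
  shows "set_integrable lborel {0<..} (\<lambda>x. x ^ k * laguerre_weight \<alpha> x)"
    and "(LBINT x:{0<..}. x ^ k * laguerre_weight \<alpha> x) = Gamma (\<alpha> + real k + 1)"
proof -
  let ?f = "\<lambda>x. indicator {0..} x * x powr (\<alpha> + real k + 1 - 1) / exp x :: real"
  have pos: "\<alpha> + real k + 1 > 0"
    using assms by simp
  have eq: "indicator {0<..} x *\<^sub>R (x ^ k * laguerre_weight \<alpha> x) = ?f x" for x :: real
    by (auto simp: indicator_def laguerre_weight_def powr_add powr_realpow exp_minus field_simps)
  have "has_bochner_integral lborel ?f (Gamma (\<alpha> + real k + 1))"
    using Gamma_real_pos[OF pos] Gamma_conv_nn_integral_real[OF pos]
    by (intro has_bochner_integral_nn_integral) (auto simp: indicator_def)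
  then show "set_integrable lborel {0<..} (\<lambda>x. x ^ k * laguerre_weight \<alpha> x)"
    and "(LBINT x:{0<..}. x ^ k * laguerre_weight \<alpha> x) = Gamma (\<alpha> + real k + 1)"
    unfolding set_integrable_def set_lebesgue_integral_def eq
    by (auto simp: has_bochner_integral_iff)
qed

lemma set_integrable_poly_laguerre_weight:
  assumes "\<alpha> > -1"
  shows "set_integrable lborel {0<..} (\<lambda>x. poly p x * laguerre_weight \<alpha> x)"
proof -
  have "set_integrable lborel {0<..}
      (\<lambda>x. \<Sum>i\<le>degree p. coeff p i * (x ^ i * laguerre_weight \<alpha> x))"
    using laguerre_weight_moment(1)[OF assms] unfolding set_integrable_def
    by (auto simp: scaleR_sum_right mult.left_commute sum_distrib_left
        intro!: Bochner_Integration.integrable_sum)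
  then show ?thesis
    by (simp add: poly_altdef sum_distrib_right mult.assoc)
qed

lemma laguerre_integral_add:
  assumes "\<alpha> > -1"
  shows "laguerre_integral \<alpha> (p + q) = laguerre_integral \<alpha> p + laguerre_integral \<alpha> q"
  unfolding laguerre_integral_def
  by (simp add: distrib_right set_integral_add[OF set_integrable_poly_laguerre_weight[OF assms]
        set_integrable_poly_laguerre_weight[OF assms]])

lemma laguerre_integral_smult: "laguerre_integral \<alpha> (smult c p) = c * laguerre_integral \<alpha> p"
  unfolding laguerre_integral_def by (simp add: mult.assoc)

lemma laguerre_integral_0: "laguerre_integral \<alpha> 0 = 0"
  unfolding laguerre_integral_def by (simp add: set_lebesgue_integral_def)

lemma laguerre_integral_sum:
  assumes "\<alpha> > -1"
  shows "laguerre_integral \<alpha> (\<Sum>i\<in>I. f i) = (\<Sum>i\<in>I. laguerre_integral \<alpha> (f i))"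
  by (induction I rule: infinite_finite_induct)
    (simp_all add: laguerre_integral_0 laguerre_integral_add[OF assms])

lemma laguerre_integral_monom:
  assumes "\<alpha> > -1"
  shows "laguerre_integral \<alpha> (monom c k) = c * Gamma (\<alpha> + real k + 1)"
  using laguerre_weight_moment(2)[OF assms, of k]
  unfolding laguerre_integral_def by (simp add: poly_monom mult.assoc)

lemma X_mult_pderiv_monom: "[:0, 1:] * pderiv (monom c k) = monom (of_nat k * c) k"
  by (rule poly_eqI) (auto simp: coeff_pderiv coeff_pCons split: nat.split)

lemma pderiv_sum: "pderiv (\<Sum>i\<in>I. f i) = (\<Sum>i\<in>I. pderiv (f i))"
  using higher_pderiv_sum[of 1 f I] by simp

text \<open>
  The identity $\int (x w_\alpha p)' = 0$, since $(x w_\alpha)' = (\alpha+1-x) w_\alpha$. On monomials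
  it is the functional equation of \<open>Gamma\<close>, so no boundary terms need to be discussed.
\<close>
lemma laguerre_integral_by_parts:
  assumes "\<alpha> > -1"
  shows "laguerre_integral \<alpha> ([:0, 1:] * pderiv p) = laguerre_integral \<alpha> ([:- \<alpha> - 1, 1:] * p)"
proof -
  have monom: "laguerre_integral \<alpha> ([:0, 1:] * pderiv (monom c k))
      = laguerre_integral \<alpha> ([:- \<alpha> - 1, 1:] * monom c k)"
    for c k
  proof -
    have r: "[:- \<alpha> - 1, 1:] * monom c k = monom c (Suc k) + monom ((- \<alpha> - 1) * c) k"
      by (simp add: monom_Suc smult_monom)
    have "Gamma (\<alpha> + real (Suc k) + 1) = (\<alpha> + real k + 1) * Gamma (\<alpha> + real k + 1)"
      using Gamma_plus1[of "\<alpha> + real k + 1"] assms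
      by (simp add: add_ac nonpos_Ints_def)
    then show ?thesis
      unfolding X_mult_pderiv_monom r laguerre_integral_add[OF assms]
        laguerre_integral_monom[OF assms]
      by (simp add: algebra_simps)
  qed
  \<comment> \<open>The coefficient function is abstracted, as rewriting \<open>p\<close> by a sum that mentions \<open>p\<close> again
    would leave \<open>p\<close> inside the coefficients.\<close>
  have "p = (\<Sum>i\<le>degree p. monom (coeff p i) i)"
    by (simp add: poly_as_sum_of_monoms)
  then obtain q where q: "p = (\<Sum>i\<le>degree p. monom (q i) i)" by metis
  show ?thesis
    by (subst (1 2) q) (simp only: pderiv_sum sum_distrib_left laguerre_integral_sum[OF assms] monom)
qed

section \<open>Laguerre polynomials\<close>

text \<open>
  The recursion results from eliminating $L_{k-1}$ between the three-term recurrence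
  $(k+1) L_{k+1} = (2k+1+\alpha-x) L_k - (k+\alpha) L_{k-1}$ and
  $x L_k' = k L_k - (k+\alpha) L_{k-1}$. As it reaches back only one step, orthogonality follows by
  induction from a single integration by parts, and the derivative rule by an equally short
  induction.
\<close>
primrec laguerre :: "real \<Rightarrow> nat \<Rightarrow> real poly" where
  "laguerre \<alpha> 0 = 1"
| "laguerre \<alpha> (Suc k) = smult (1 / (real k + 1))
     ([:0, 1:] * pderiv (laguerre \<alpha> k) + [:real k + 1 + \<alpha>, - 1:] * laguerre \<alpha> k)"

lemma laguerre_Suc_smult:
  "smult (real k + 1) (laguerre \<alpha> (Suc k)) =
     [:0, 1:] * pderiv (laguerre \<alpha> k) + [:real k + 1 + \<alpha>, - 1:] * laguerre \<alpha> k"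
  by simp

declare laguerre.simps(2)[simp del]

lemma degree_laguerre_le: "degree (laguerre \<alpha> k) \<le> k"
  and coeff_laguerre_top: "coeff (laguerre \<alpha> k) k = (- 1) ^ k / fact k"
proof (induction k)
  case (Suc k)
  {
    case 1
    show ?case
    proof (rule degree_le, intro allI impI)
      fix i assume "i > Suc k"
      then obtain j where i: "i = Suc j" "j > k" by (cases i) auto
      then have "coeff (laguerre \<alpha> k) j = 0" "coeff (laguerre \<alpha> k) (Suc j) = 0"
        using Suc(1) by (auto intro: coeff_eq_0)
      then show "coeff (laguerre \<alpha> (Suc k)) i = 0"
        by (simp add: laguerre.simps i coeff_pderiv)
    qed
  next
    case 2
    have "coeff (laguerre \<alpha> k) (Suc k) = 0"
      using Suc(1) by (auto intro: coeff_eq_0)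
    then have "coeff (laguerre \<alpha> (Suc k)) (Suc k) = - coeff (laguerre \<alpha> k) k / (real k + 1)"
      by (simp add: laguerre.simps coeff_pderiv)
    then show ?case
      by (simp add: Suc(2) algebra_simps)
  }
qed simp_all

text \<open>
  Inserting the recursion and integrating $x L_k' q$ by parts cancels all terms but one:
  $(k+1)\int L_{k+1}\,q\,w_\alpha = \int L_k\,(k q - x q')\,w_\alpha$. For $q = x^m$ the factor is
  $(k-m) x^m$, which vanishes at $m = k$; this is how every moment of order less than the degree
  disappears, and it produces the binomial coefficient.
\<close>
lemma laguerre_integral_laguerre_monom:
  assumes "\<alpha> > -1"
  shows "laguerre_integral \<alpha> (laguerre \<alpha> k * monom 1 m) =
           (- 1) ^ k * real (m choose k) * Gamma (\<alpha> + real m + 1)"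
proof (induction k)
  case 0
  then show ?case by (simp add: laguerre_integral_monom[OF assms])
next
  case (Suc k)
  define L where "L = laguerre \<alpha> k"
  define M where "M = monom (1::real) m"
  have M: "[:0, 1:] * pderiv M = smult (real m) M"
    unfolding M_def X_mult_pderiv_monom by (simp add: smult_monom)
  have "[:0, 1:] * pderiv (L * M) = [:0, 1:] * pderiv L * M + smult (real m) (L * M)"
    unfolding pderiv_mult distrib_left mult.left_commute[of "[:0, 1:]" L] M
    by (simp only: mult_smult_right mult_ac add.commute)
  then have parts: "laguerre_integral \<alpha> ([:0, 1:] * pderiv L * M) =
      laguerre_integral \<alpha> ([:- \<alpha> - 1, 1:] * (L * M)) - real m * laguerre_integral \<alpha> (L * M)"
    using laguerre_integral_by_parts[OF assms, of "L * M"]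
    by (simp add: laguerre_integral_add[OF assms] laguerre_integral_smult)
  have "smult (real k + 1) (laguerre \<alpha> (Suc k) * M) =
      [:0, 1:] * pderiv L * M + [:real k + 1 + \<alpha>, - 1:] * (L * M)"
    unfolding mult_smult_left[symmetric] laguerre_Suc_smult L_def by (simp only: algebra_simps)
  then have "(real k + 1) * laguerre_integral \<alpha> (laguerre \<alpha> (Suc k) * M) =
      laguerre_integral \<alpha> ([:- \<alpha> - 1, 1:] * (L * M))
        + laguerre_integral \<alpha> ([:real k + 1 + \<alpha>, - 1:] * (L * M))
        - real m * laguerre_integral \<alpha> (L * M)"
    using parts
      by (metis (no_types, opaque_lifting) add.commute add_diff_eq
          laguerre_integral_add[OF assms] laguerre_integral_smult)
  also have "\<dots> = laguerre_integral \<alpha> (([:- \<alpha> - 1, 1:] + [:real k + 1 + \<alpha>, - 1:]) * (L * M))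
        - real m * laguerre_integral \<alpha> (L * M)"
    by (simp only: distrib_right laguerre_integral_add[OF assms])
  also have "[:- \<alpha> - 1, 1:] + [:real k + 1 + \<alpha>, - 1:] = [:real k:]"
    by simp
  also have "laguerre_integral \<alpha> ([:real k:] * (L * M)) - real m * laguerre_integral \<alpha> (L * M)
      = (real k - real m) * laguerre_integral \<alpha> (L * M)"
    by (simp add: laguerre_integral_smult algebra_simps)
  finally have step: "(real k + 1) * laguerre_integral \<alpha> (laguerre \<alpha> (Suc k) * M)
      = (real k - real m) * ((- 1) ^ k * real (m choose k) * Gamma (\<alpha> + real m + 1))"
    using Suc by (simp add: L_def M_def)
  have binom: "(real k + 1) * real (m choose Suc k) = (real m - real k) * real (m choose k)"
  proof (cases "k \<le> m")
    case True
    have "Suc k * (m choose Suc k) = (m - k) * (m choose k)"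
      by (simp only: binomial_absorption binomial_absorb_comp)
    then have "real (Suc k * (m choose Suc k)) = real ((m - k) * (m choose k))"
      by (rule arg_cong)
    with True show ?thesis by (simp add: of_nat_diff algebra_simps)
  qed (simp add: binomial_eq_0)
  have "(real k + 1) * ((- 1) ^ Suc k * real (m choose Suc k) * Gamma (\<alpha> + real m + 1))
      = - ((- 1) ^ k * Gamma (\<alpha> + real m + 1)) * ((real k + 1) * real (m choose Suc k))"
    by simp
  also have "\<dots> = (real k - real m) * ((- 1) ^ k * real (m choose k) * Gamma (\<alpha> + real m + 1))"
    unfolding binom by (simp add: algebra_simps)
  finally have "(real k + 1) * laguerre_integral \<alpha> (laguerre \<alpha> (Suc k) * M)
      = (real k + 1) * ((- 1) ^ Suc k * real (m choose Suc k) * Gamma (\<alpha> + real m + 1))"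
    using step by simp
  moreover have "real k + 1 \<noteq> 0" by linarith
  ultimately show ?case
    unfolding M_def by (simp only: mult_cancel_left simp_thms)
qed

text \<open>
  The two identities carry each other: differentiating the recursion shows that
  $(k+1)(L_{k+1}' - L_k' + L_k)$ equals the left-hand side of Laguerre's equation for $L_k$, and the
  derivative rule in turn transports the equation from $L_k$ to $L_{k+1}$.
\<close>
lemma laguerre_ode:
  "[:0, 1:] * pderiv (pderiv (laguerre \<alpha> k)) + [:1 + \<alpha>, - 1:] * pderiv (laguerre \<alpha> k)
     + smult (real k) (laguerre \<alpha> k) = 0"
  and pderiv_laguerre_Suc: "pderiv (laguerre \<alpha> (Suc k)) = pderiv (laguerre \<alpha> k) - laguerre \<alpha> k"
proof -
  have rec: "smult (real k + 1) (laguerre \<alpha> (Suc k)) = [:0, 1:] * pderiv (laguerre \<alpha> k)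
      + [:1 + \<alpha>, - 1:] * laguerre \<alpha> k + smult (real k) (laguerre \<alpha> k)" for k
    unfolding laguerre_Suc_smult by (simp add: algebra_simps smult_add_left)
  have step: "pderiv (laguerre \<alpha> (Suc k)) = pderiv (laguerre \<alpha> k) - laguerre \<alpha> k"
    if ode: "[:0, 1:] * pderiv (pderiv (laguerre \<alpha> k)) + [:1 + \<alpha>, - 1:] * pderiv (laguerre \<alpha> k)
      + smult (real k) (laguerre \<alpha> k) = 0" for k
  proof -
    have "smult (real k + 1) (pderiv (laguerre \<alpha> (Suc k)))
        = pderiv ([:0, 1:] * pderiv (laguerre \<alpha> k) + [:1 + \<alpha>, - 1:] * laguerre \<alpha> k
            + smult (real k) (laguerre \<alpha> k))"
      by (simp only: pderiv_smult[symmetric] rec)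
    also have "\<dots>
        = ([:0, 1:] * pderiv (pderiv (laguerre \<alpha> k)) + [:1 + \<alpha>, - 1:] * pderiv (laguerre \<alpha> k)
        + smult (real k) (laguerre \<alpha> k)) + smult (real k + 1) (pderiv (laguerre \<alpha> k) - laguerre \<alpha> k)"
      by (simp add: pderiv_add pderiv_mult pderiv_pCons pderiv_smult pderiv_minus smult_add_left smult_diff_right)
    finally show ?thesis
      unfolding ode by (simp add: smult_eq_iff)
  qed
  show ode: "[:0, 1:] * pderiv (pderiv (laguerre \<alpha> k)) + [:1 + \<alpha>, - 1:] * pderiv (laguerre \<alpha> k)
     + smult (real k) (laguerre \<alpha> k) = 0" for k
  proof (induction k)
    case (Suc k)
    note ode = Suc
    have k: "real (Suc k) = real k + 1" by simp
    have "[:0, 1:] * pderiv (pderiv (laguerre \<alpha> (Suc k)))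
        + [:1 + \<alpha>, - 1:] * pderiv (laguerre \<alpha> (Suc k))
        + smult (real (Suc k)) (laguerre \<alpha> (Suc k))
      = [:0, 1:] * pderiv (pderiv (laguerre \<alpha> k)) + [:1 + \<alpha>, - 1:] * pderiv (laguerre \<alpha> k)
        + smult (real k) (laguerre \<alpha> k)"
      unfolding k rec step[OF ode] pderiv_diff right_diff_distrib by simp
    then show ?case using ode by simp
  qed simp
  show "pderiv (laguerre \<alpha> (Suc k)) = pderiv (laguerre \<alpha> k) - laguerre \<alpha> k"
    by (rule step[OF ode])
qed

lemma pderiv_laguerre: "pderiv (laguerre \<alpha> k) = - (\<Sum>j<k. laguerre \<alpha> j)"
  by (induction k) (simp_all add: pderiv_laguerre_Suc)

section \<open>Orthogonality and expansion\<close>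

text \<open>The squared norm $h_k$ of $L_k$, in the customary notation.\<close>
definition laguerre_h :: "real \<Rightarrow> nat \<Rightarrow> real" where
  "laguerre_h \<alpha> k = Gamma (\<alpha> + real k + 1) / fact k"

lemma laguerre_h_pos: "\<alpha> > -1 \<Longrightarrow> laguerre_h \<alpha> k > 0"
  unfolding laguerre_h_def by (intro divide_pos_pos Gamma_real_pos) simp_all

lemma laguerre_h_Suc:
  assumes "\<alpha> > -1"
  shows "laguerre_h \<alpha> (Suc k) = laguerre_h \<alpha> k * (\<alpha> + real k + 1) / (real k + 1)"
proof -
  have "Gamma (\<alpha> + real (Suc k) + 1) = (\<alpha> + real k + 1) * Gamma (\<alpha> + real k + 1)"
    using Gamma_plus1[of "\<alpha> + real k + 1"] assms
    by (simp add: add_ac nonpos_Ints_def)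
  then show ?thesis
    unfolding laguerre_h_def by (simp add: algebra_simps)
qed

text \<open>
  Of the monomials of degree at most $k$, only $x^k$ is not orthogonal to $L_k$. With
  $q = L_j$, this is at once orthogonality ($j < k$) and the value of $h_k$ ($j = k$).
\<close>
lemma laguerre_integral_laguerre_mult:
  assumes "\<alpha> > -1" "degree q \<le> k"
  shows "laguerre_integral \<alpha> (laguerre \<alpha> k * q) = coeff q k * (- 1) ^ k * Gamma (\<alpha> + real k + 1)"
proof -
  have "laguerre_integral \<alpha> (laguerre \<alpha> k * q)
      = laguerre_integral \<alpha> (\<Sum>i\<le>k. smult (coeff q i) (laguerre \<alpha> k * monom 1 i))"
    by (subst (1) poly_as_sum_of_monoms'[OF assms(2), symmetric])
       (simp add: sum_distrib_left smult_monom flip: mult_smult_right)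
  also have "\<dots> = (\<Sum>i\<le>k. coeff q i * ((- 1) ^ k * real (i choose k) * Gamma (\<alpha> + real i + 1)))"
    by (simp only: laguerre_integral_sum[OF assms(1)] laguerre_integral_smult
        laguerre_integral_laguerre_monom[OF assms(1)])
  also have "\<dots> = (\<Sum>i\<in>{k}. coeff q i * ((- 1) ^ k * real (i choose k) * Gamma (\<alpha> + real i + 1)))"
    by (intro sum.mono_neutral_right) auto
  finally show ?thesis by simp
qed

lemma laguerre_orthogonal:
  assumes "\<alpha> > -1"
  shows "laguerre_integral \<alpha> (laguerre \<alpha> j * laguerre \<alpha> k) = (if j = k then laguerre_h \<alpha> k else 0)"
proof -
  have less: "laguerre_integral \<alpha> (laguerre \<alpha> k * laguerre \<alpha> j) = 0" if "j < k" for j k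
  proof -
    have "degree (laguerre \<alpha> j) < k"
      using degree_laguerre_le[of \<alpha> j] that by simp
    then show ?thesis
      using laguerre_integral_laguerre_mult[OF assms, of "laguerre \<alpha> j" k] by (simp add: coeff_eq_0)
  qed
  have "laguerre_integral \<alpha> (laguerre \<alpha> k * laguerre \<alpha> k) = laguerre_h \<alpha> k"
    using laguerre_integral_laguerre_mult[OF assms degree_laguerre_le, of k]
    by (simp add: coeff_laguerre_top laguerre_h_def flip: power_mult_distrib)
  then show ?thesis
    using less[of j k] less[of k j] by (cases j k rule: linorder_cases) (auto simp: mult.commute)
qed

lemma laguerre_expansion:
  assumes "degree p \<le> n"
  obtains a where "p = (\<Sum>k\<le>n. smult (a k) (laguerre \<alpha> k))"
proof -
  have "\<exists>a. p = (\<Sum>k\<le>n. smult (a k) (laguerre \<alpha> k))"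
    using assms
  proof (induction n arbitrary: p)
    case 0
    then obtain c where "p = [:c:]" by (auto elim: degree_eq_zeroE)
    then show ?case by (intro exI[of _ "\<lambda>_. c"]) simp
  next
    case (Suc n)
    define c where "c = coeff p (Suc n) / coeff (laguerre \<alpha> (Suc n)) (Suc n)"
    have "degree (p - smult c (laguerre \<alpha> (Suc n))) \<le> n"
    proof (rule degree_le, intro allI impI)
      fix i assume "n < i"
      then consider "i = Suc n" | "i > Suc n" by linarith
      then show "coeff (p - smult c (laguerre \<alpha> (Suc n))) i = 0"
      proof cases
        case 1
        then show ?thesis by (simp add: c_def coeff_laguerre_top)
      next
        case 2
        then have "coeff p i = 0" "coeff (laguerre \<alpha> (Suc n)) i = 0"
          using Suc.prems degree_laguerre_le[of \<alpha> "Suc n"] by (auto intro: coeff_eq_0)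
        then show ?thesis by simp
      qed
    qed
    from Suc.IH[OF this] obtain a
      where a: "p - smult c (laguerre \<alpha> (Suc n)) = (\<Sum>k\<le>n. smult (a k) (laguerre \<alpha> k))" by blast
    have "(\<Sum>k\<le>n. smult ((a(Suc n := c)) k) (laguerre \<alpha> k)) = (\<Sum>k\<le>n. smult (a k) (laguerre \<alpha> k))"
      by (intro sum.cong) auto
    with a have "p = (\<Sum>k\<le>Suc n. smult ((a(Suc n := c)) k) (laguerre \<alpha> k))"
      by (simp add: algebra_simps)
    then show ?case by blast
  qed
  then show ?thesis using that by blast
qed

text \<open>Parseval's identity for the orthogonal system of Laguerre polynomials.\<close>
lemma laguerre_norm_expansion:
  assumes "\<alpha> > -1" "finite I"
  shows "laguerre_norm \<alpha> (poly (\<Sum>k\<in>I. smult (a k) (laguerre \<alpha> k)))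
    = sqrt (\<Sum>k\<in>I. laguerre_h \<alpha> k * (a k)\<^sup>2)"
proof -
  let ?p = "\<Sum>k\<in>I. smult (a k) (laguerre \<alpha> k)"
  have "?p * ?p = (\<Sum>j\<in>I. \<Sum>k\<in>I. smult (a j * a k) (laguerre \<alpha> j * laguerre \<alpha> k))"
    by (simp only: sum_product mult_smult_left mult_smult_right smult_smult mult.commute)
  then have "laguerre_integral \<alpha> (?p * ?p)
      = (\<Sum>j\<in>I. \<Sum>k\<in>I. a j * a k * (if j = k then laguerre_h \<alpha> k else 0))"
    by (simp only: laguerre_integral_sum[OF assms(1)] laguerre_integral_smult
        laguerre_orthogonal[OF assms(1)])
  also have "\<dots> = (\<Sum>k\<in>I. laguerre_h \<alpha> k * (a k)\<^sup>2)"
    using assms(2)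
      by (simp add: if_distrib[of "\<lambda>x. _ * x"] sum.delta power2_eq_square mult_ac cong: if_cong)
  finally show ?thesis
    by (simp add: laguerre_norm_def laguerre_integral_def power2_eq_square)
qed

lemma smult_sum_right: "smult c (\<Sum>i\<in>I. f i) = (\<Sum>i\<in>I. smult c (f i))"
  by (induction I rule: infinite_finite_induct) (simp_all add: smult_add_right)

lemma pderiv_laguerre_expansion:
  "pderiv (\<Sum>k\<le>n. smult (a k) (laguerre \<alpha> k))
     = (\<Sum>j<n. smult (- (\<Sum>k\<in>{j<..n}. a k)) (laguerre \<alpha> j))"
proof -
  have "pderiv (\<Sum>k\<le>n. smult (a k) (laguerre \<alpha> k))
      = (\<Sum>k\<le>n. \<Sum>j | j \<in> {..<n} \<and> j < k. smult (- a k) (laguerre \<alpha> j))"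
    unfolding pderiv_sum pderiv_smult pderiv_laguerre
  proof (intro sum.cong refl)
    fix k assume "k \<in> {..n}"
    then have "{j. j \<in> {..<n} \<and> j < k} = {..<k}" by auto
    then show "smult (a k) (- (\<Sum>j<k. laguerre \<alpha> j))
        = (\<Sum>j | j \<in> {..<n} \<and> j < k. smult (- a k) (laguerre \<alpha> j))"
      by (simp add: smult_sum_right sum_negf)
  qed
  also have "\<dots> = (\<Sum>j<n. \<Sum>k | k \<in> {..n} \<and> j < k. smult (- a k) (laguerre \<alpha> j))"
    by (rule sum.swap_restrict) auto
  also have "\<dots> = (\<Sum>j<n. smult (\<Sum>k | k \<in> {..n} \<and> j < k. - a k) (laguerre \<alpha> j))"
    by (simp only: smult_sum)
  also have "\<dots> = (\<Sum>j<n. smult (- (\<Sum>k\<in>{j<..n}. a k)) (laguerre \<alpha> j))"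
    by (auto simp: sum_negf intro!: sum.cong arg_cong2[of _ _ _ _ smult])
  finally show ?thesis .
qed

section \<open>The Markov constant as a Rayleigh quotient\<close>

text \<open>
  \<open>norm_form\<close> and \<open>deriv_form\<close> are the squared norms of $p$ and of $p'$ as quadratic forms in the
  Laguerre coefficients of $p$.
\<close>
definition norm_form :: "real \<Rightarrow> nat \<Rightarrow> (nat \<Rightarrow> real) \<Rightarrow> real" where
  "norm_form \<alpha> n a = (\<Sum>k\<le>n. laguerre_h \<alpha> k * (a k)\<^sup>2)"

definition deriv_form :: "real \<Rightarrow> nat \<Rightarrow> (nat \<Rightarrow> real) \<Rightarrow> real" where
  "deriv_form \<alpha> n a = (\<Sum>j<n. laguerre_h \<alpha> j * (\<Sum>k\<in>{j<..n}. a k)\<^sup>2)"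

lemma norm_form_nonneg: "\<alpha> > -1 \<Longrightarrow> norm_form \<alpha> n a \<ge> 0"
  unfolding norm_form_def
    by (intro sum_nonneg mult_nonneg_nonneg) (auto intro: less_imp_le laguerre_h_pos)

lemma deriv_form_nonneg: "\<alpha> > -1 \<Longrightarrow> deriv_form \<alpha> n a \<ge> 0"
  unfolding deriv_form_def
  by (intro sum_nonneg mult_nonneg_nonneg) (auto intro: less_imp_le laguerre_h_pos)

lemma markov_quotient_expansion:
  assumes "\<alpha> > -1" and p: "p = (\<Sum>k\<le>n. smult (a k) (laguerre \<alpha> k))"
  shows "laguerre_norm \<alpha> (poly (pderiv p)) / laguerre_norm \<alpha> (poly p)
           = sqrt (deriv_form \<alpha> n a / norm_form \<alpha> n a)"
  unfolding p pderiv_laguerre_expansion laguerre_norm_expansion[OF assms(1) finite_lessThan]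
    laguerre_norm_expansion[OF assms(1) finite_atMost]
  by (simp add: norm_form_def deriv_form_def real_sqrt_divide)

text \<open>
  A bound between the two quadratic forms bounds every Markov quotient, because the Laguerre
  polynomials of degree at most \<open>n\<close> span all polynomials of degree at most \<open>n\<close>.
\<close>
lemma markov_quotient_le:
  assumes "\<alpha> > -1" "degree p \<le> n" "K \<ge> 0"
    and "\<And>a. deriv_form \<alpha> n a \<le> K * norm_form \<alpha> n a"
  shows "laguerre_norm \<alpha> (poly (pderiv p)) / laguerre_norm \<alpha> (poly p) \<le> sqrt K"
proof -
  obtain a where a: "p = (\<Sum>k\<le>n. smult (a k) (laguerre \<alpha> k))"
    using laguerre_expansion[OF assms(2)] .
  show ?thesis
    unfolding markov_quotient_expansion[OF assms(1) a]
    using assms(4)[of a] norm_form_nonneg[OF assms(1), of n a] assms(3)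
    by (cases "norm_form \<alpha> n a = 0") (auto simp: divide_le_eq)
qed

lemma laguerre_h_ge:
  assumes "\<alpha> > -1" "k \<ge> 1"
  shows "(\<alpha> + 1) * laguerre_h \<alpha> 0 \<le> real k * laguerre_h \<alpha> k"
  using assms(2)
proof (induction k rule: nat_induct_at_least)
  case base
  show ?case by (simp add: laguerre_h_Suc[OF assms(1)])
next
  case (Suc k)
  have "real k * laguerre_h \<alpha> k \<le> (\<alpha> + real k + 1) * laguerre_h \<alpha> k"
    using assms(1) by (intro mult_right_mono) (auto intro: less_imp_le laguerre_h_pos)
  also have "\<dots> = real (Suc k) * laguerre_h \<alpha> (Suc k)"
    by (simp add: laguerre_h_Suc[OF assms(1)] field_simps)
  finally show ?case using Suc by simp
qed

lemma sum_real_atMost: "(\<Sum>k\<le>n. real k) = real n * (real n + 1) / 2"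
  by (induction n) (simp_all add: field_simps)

text \<open>
  Cauchy-Schwarz with the weights $k$ bounds every tail $S_j$ at once, and $1/k$ is compared with
  $h_k$ by \<open>laguerre_h_ge\<close>. Besides being asymptotically sharp at $-1$, the bound holds for all
  $\alpha > -1$; this is what shows the Markov quotients to be bounded.
\<close>
lemma deriv_form_le_near_minus_1:
  assumes "\<alpha> > -1"
  shows "deriv_form \<alpha> n a
    \<le> (real n * (real n + 1) / 2) * (\<Sum>j<n. laguerre_h \<alpha> j / laguerre_h \<alpha> 0) / (\<alpha> + 1) * norm_form \<alpha> n a"
proof -
  define e where "e = (\<alpha> + 1) * laguerre_h \<alpha> 0"
  have h0: "laguerre_h \<alpha> 0 > 0" and e: "e > 0"
    using assms laguerre_h_pos[OF assms, of 0] by (auto simp: e_def)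
  have tail: "(\<Sum>k\<in>{j<..n}. a k)\<^sup>2 \<le> (real n * (real n + 1) / 2) / e * norm_form \<alpha> n a" for j
  proof -
    have "(\<Sum>k\<in>{j<..n}. a k)\<^sup>2 = (\<Sum>k\<in>{j<..n}. sqrt (real k) * (a k / sqrt (real k)))\<^sup>2"
      by (intro arg_cong[of _ _ "\<lambda>x. x\<^sup>2"] sum.cong) auto
    also have "\<dots> \<le> (\<Sum>k\<in>{j<..n}. (sqrt (real k))\<^sup>2) * (\<Sum>k\<in>{j<..n}. (a k / sqrt (real k))\<^sup>2)"
      by (rule Cauchy_Schwarz_ineq_sum)
    also have "\<dots> \<le> (real n * (real n + 1) / 2) * (norm_form \<alpha> n a / e)"
    proof (intro mult_mono sum_nonneg)
      have "(\<Sum>k\<in>{j<..n}. (sqrt (real k))\<^sup>2) \<le> (\<Sum>k\<le>n. real k)"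
        by simp (intro sum_mono2, auto)
      also have "\<dots> = real n * (real n + 1) / 2"
        by (rule sum_real_atMost)
      finally show "(\<Sum>k\<in>{j<..n}. (sqrt (real k))\<^sup>2) \<le> real n * (real n + 1) / 2" .
      have "(\<Sum>k\<in>{j<..n}. (a k / sqrt (real k))\<^sup>2) \<le> (\<Sum>k\<in>{j<..n}. laguerre_h \<alpha> k * (a k)\<^sup>2 / e)"
      proof (intro sum_mono)
        fix k assume "k \<in> {j<..n}"
        then have k: "k \<ge> 1" by simp
        then have "1 / real k \<le> laguerre_h \<alpha> k / e"
          using laguerre_h_ge[OF assms k] e by (simp add: e_def field_simps)
        from mult_right_mono[OF this, of "(a k)\<^sup>2"]
        show "(a k / sqrt (real k))\<^sup>2 \<le> laguerre_h \<alpha> k * (a k)\<^sup>2 / e"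
          by (simp add: power_divide)
      qed
      also have "\<dots> \<le> (\<Sum>k\<le>n. laguerre_h \<alpha> k * (a k)\<^sup>2 / e)"
        using e laguerre_h_pos[OF assms] by (intro sum_mono2) (auto simp: less_imp_le)
      finally show "(\<Sum>k\<in>{j<..n}. (a k / sqrt (real k))\<^sup>2) \<le> norm_form \<alpha> n a / e"
        by (simp add: norm_form_def sum_divide_distrib)
    qed auto
    finally show ?thesis by simp
  qed
  have "deriv_form \<alpha> n a
      \<le> (\<Sum>j<n. laguerre_h \<alpha> j * ((real n * (real n + 1) / 2) / e * norm_form \<alpha> n a))"
    unfolding deriv_form_def
    using tail laguerre_h_pos[OF assms] by (intro sum_mono mult_left_mono) (auto simp: less_imp_le)
  also have "\<dots> = (\<Sum>j<n. laguerre_h \<alpha> j) * ((real n * (real n + 1) / 2) / e * norm_form \<alpha> n a)"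
    by (simp only: sum_distrib_right)
  also have "\<dots>
      = (real n * (real n + 1) / 2) * ((\<Sum>j<n. laguerre_h \<alpha> j) / laguerre_h \<alpha> 0) / (\<alpha> + 1) * norm_form \<alpha> n a"
    by (simp add: e_def mult_ac)
  finally show ?thesis by (simp only: sum_divide_distrib)
qed

text \<open>
  Any test polynomial bounds the supremum from below. Since a supremum of reals says nothing about an
  unbounded set, boundedness has to be established first.
\<close>
lemma markov_const_sq_ge:
  assumes "\<alpha> > -1" "norm_form \<alpha> n a > 0"
  shows "deriv_form \<alpha> n a / norm_form \<alpha> n a \<le> (markov_const n \<alpha>)\<^sup>2"
    and "markov_const n \<alpha> \<ge> 0"
proof -
  define p where "p = (\<Sum>k\<le>n. smult (a k) (laguerre \<alpha> k))"
  define K where "K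
      = (real n * (real n + 1) / 2) * (\<Sum>j<n. laguerre_h \<alpha> j / laguerre_h \<alpha> 0) / (\<alpha> + 1)"
  have K: "K \<ge> 0"
    unfolding K_def using assms(1) laguerre_h_pos[OF assms(1)]
    by (intro divide_nonneg_nonneg mult_nonneg_nonneg sum_nonneg) (auto simp: less_imp_le)
  have bdd: "bdd_above ((\<lambda>p. laguerre_norm \<alpha> (poly (pderiv p)) / laguerre_norm \<alpha> (poly p))
      ` (polys_upto n - {0}))"
    using markov_quotient_le[OF assms(1) _ K, of _ n]
      deriv_form_le_near_minus_1[OF assms(1), of n]
    by (intro bdd_aboveI2[where M = "sqrt K"]) (auto simp: polys_upto_def K_def)
  have "degree p \<le> n"
    unfolding p_def
    by (intro degree_sum_le) (auto intro: order.trans[OF degree_smult_le] order.trans[OF degree_laguerre_le])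
  moreover have "p \<noteq> 0"
  proof
    assume "p = 0"
    then have "laguerre_norm \<alpha> (poly p) = 0"
      by (simp add: laguerre_norm_def set_lebesgue_integral_def)
    with laguerre_norm_expansion[OF assms(1), of "{..n}" a] assms(2) show False
      by (simp add: p_def norm_form_def)
  qed
  ultimately have "sqrt (deriv_form \<alpha> n a / norm_form \<alpha> n a) \<le> markov_const n \<alpha>"
    unfolding markov_const_def markov_quotient_expansion[OF assms(1) p_def, symmetric]
    by (intro cSUP_upper[OF _ bdd]) (simp add: polys_upto_def)
  moreover have "0 \<le> deriv_form \<alpha> n a / norm_form \<alpha> n a"
    using assms deriv_form_nonneg by simp
  ultimately show "deriv_form \<alpha> n a / norm_form \<alpha> n a \<le> (markov_const n \<alpha>)\<^sup>2" "markov_const n \<alpha> \<ge> 0"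
    using real_sqrt_ge_zero[of "deriv_form \<alpha> n a / norm_form \<alpha> n a"]
    by (auto simp del: real_sqrt_ge_0_iff intro: sqrt_le_D order.trans)
qed

lemma markov_const_sq_le:
  assumes "\<alpha> > -1" "K \<ge> 0" "\<And>a. deriv_form \<alpha> n a \<le> K * norm_form \<alpha> n a"
  shows "(markov_const n \<alpha>)\<^sup>2 \<le> K"
proof -
  have "1 \<in> polys_upto n - {0}" by (simp add: polys_upto_def)
  then have "polys_upto n - {0} \<noteq> {}" by blast
  then have "markov_const n \<alpha> \<le> sqrt K"
    unfolding markov_const_def using markov_quotient_le[OF assms(1) _ assms(2,3)]
    by (rule cSUP_least) (simp add: polys_upto_def)
  moreover have "norm_form \<alpha> n (\<lambda>k. if k = 0 then 1 else 0) > 0"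
    using laguerre_h_pos[OF assms(1), of 0]
    by (simp add: norm_form_def if_distrib[of "\<lambda>x. x\<^sup>2"] if_distrib[of "\<lambda>x. _ * x"] sum.delta cong: if_cong)
  then have "markov_const n \<alpha> \<ge> 0"
    by (rule markov_const_sq_ge(2)[OF assms(1)])
  ultimately show ?thesis
    using assms(2) power_mono[of "markov_const n \<alpha>" "sqrt K" 2] by simp
qed

section \<open>The limit at $-1$\<close>

text \<open>
  For $k \ge 1$ this is $h_k/h_0 \sim (\alpha+1)/k$. The factor $k^2$ turns the quotient into a summand of
  $\|p\|^2/((\alpha+1)h_0)$ for the extremal coefficients $a_k = k$, and makes the statement
  true for $k = 0$ as well.
\<close>
lemma laguerre_h_ratio_at_minus_1:
  "((\<lambda>\<alpha>. (real k)\<^sup>2 * laguerre_h \<alpha> k / ((\<alpha> + 1) * laguerre_h \<alpha> 0)) \<longlongrightarrow> real k) (at_right (- 1))"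
proof (cases k)
  case (Suc m)
  have "((\<lambda>\<alpha>. laguerre_h \<alpha> (Suc m) / ((\<alpha> + 1) * laguerre_h \<alpha> 0))
      \<longlongrightarrow> 1 / (real m + 1)) (at_right (- 1))"
  proof (induction m)
    case 0
    have "\<forall>\<^sub>F \<alpha> in at_right (-1::real). laguerre_h \<alpha> (Suc 0) / ((\<alpha> + 1) * laguerre_h \<alpha> 0) = 1"
      using eventually_at_right_less[of "-1::real"]
    proof eventually_elim
      case (elim \<alpha>)
      then show ?case
        using laguerre_h_pos[of \<alpha> 0] by (simp add: laguerre_h_Suc)
    qed
    then show ?case by (simp add: tendsto_eventually)
  next
    case (Suc m)
    have "((\<lambda>\<alpha>. laguerre_h \<alpha> (Suc m) / ((\<alpha> + 1) * laguerre_h \<alpha> 0) * ((\<alpha> + real (Suc m) + 1) / (real (Suc m) + 1)))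
        \<longlongrightarrow> 1 / (real m + 1) * ((-1 + real (Suc m) + 1) / (real (Suc m) + 1))) (at_right (- 1))"
      by (intro tendsto_intros Suc) auto
    moreover have "1 / (real m + 1) * ((-1 + real (Suc m) + 1) / (real (Suc m) + 1))
        = 1 / (real (Suc m) + 1)"
      by (simp add: field_simps)
    moreover have "\<forall>\<^sub>F \<alpha> in at_right (-1::real).
        laguerre_h \<alpha> (Suc m) / ((\<alpha> + 1) * laguerre_h \<alpha> 0) * ((\<alpha> + real (Suc m) + 1) / (real (Suc m) + 1))
          = laguerre_h \<alpha> (Suc (Suc m)) / ((\<alpha> + 1) * laguerre_h \<alpha> 0)"
      using eventually_at_right_less[of "-1::real"]
      by eventually_elim (simp add: laguerre_h_Suc[where k = "Suc m"] mult_ac)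
    ultimately show ?case
      using Lim_transform_eventually by fastforce
  qed
  from tendsto_mult_left[OF this, of "(real k)\<^sup>2"] show ?thesis
    by (simp add: Suc power2_eq_square add_ac)
qed simp

lemma laguerre_h_div_at_minus_1:
  "((\<lambda>\<alpha>. laguerre_h \<alpha> j / laguerre_h \<alpha> 0) \<longlongrightarrow> (if j = 0 then 1 else 0)) (at_right (- 1))"
proof (cases "j = 0")
  case True
  have "\<forall>\<^sub>F \<alpha> in at_right (-1::real). laguerre_h \<alpha> 0 / laguerre_h \<alpha> 0 = 1"
    using eventually_at_right_less[of "-1::real"]
    by eventually_elim (simp add: less_imp_neq[OF laguerre_h_pos, symmetric])
  with True show ?thesis by (simp add: tendsto_eventually)
next
  case False
  have "((\<lambda>\<alpha>. (real j)\<^sup>2 * laguerre_h \<alpha> j / ((\<alpha> + 1) * laguerre_h \<alpha> 0) * ((\<alpha> + 1) / (real j)\<^sup>2))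
      \<longlongrightarrow> real j * ((-1 + 1) / (real j)\<^sup>2)) (at_right (- 1))"
    by (intro tendsto_mult laguerre_h_ratio_at_minus_1 tendsto_intros) (use False in auto)
  moreover have "\<forall>\<^sub>F \<alpha> in at_right (-1::real).
      (real j)\<^sup>2 * laguerre_h \<alpha> j / ((\<alpha> + 1) * laguerre_h \<alpha> 0) * ((\<alpha> + 1) / (real j)\<^sup>2) = laguerre_h \<alpha> j / laguerre_h \<alpha> 0"
    using eventually_at_right_less[of "-1::real"]
    by eventually_elim (use False in simp)
  ultimately show ?thesis
    using False Lim_transform_eventually by fastforce
qed

lemma markov_const_at_minus_1:
  "((\<lambda>\<alpha>. (\<alpha> + 1) * (markov_const n \<alpha>)\<^sup>2) \<longlongrightarrow> real n * (real n + 1) / 2) (at_right (- 1))"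
proof -
  define N where "N = real n * (real n + 1) / 2"
  define U where "U \<alpha> = N * (\<Sum>j<n. laguerre_h \<alpha> j / laguerre_h \<alpha> 0)" for \<alpha>
  define V where "V \<alpha>
      = N\<^sup>2 / (\<Sum>k\<le>n. (real k)\<^sup>2 * laguerre_h \<alpha> k / ((\<alpha> + 1) * laguerre_h \<alpha> 0))" for \<alpha>
  have sumN: "(\<Sum>k\<le>n. real k) = N"
    unfolding N_def by (rule sum_real_atMost)
  have near: "\<forall>\<^sub>F \<alpha> in at_right (-1::real). -1 < \<alpha>"
    by (rule eventually_at_right_less)
  have up: "\<forall>\<^sub>F \<alpha> in at_right (-1::real). (\<alpha> + 1) * (markov_const n \<alpha>)\<^sup>2 \<le> U \<alpha>"
    using near
  proof eventually_elim
    case (elim \<alpha>)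
    have U: "U \<alpha> \<ge> 0"
      unfolding U_def N_def using laguerre_h_pos[OF elim]
      by (intro mult_nonneg_nonneg sum_nonneg) (auto simp: less_imp_le)
    have "(markov_const n \<alpha>)\<^sup>2 \<le> U \<alpha> / (\<alpha> + 1)"
      using deriv_form_le_near_minus_1[OF elim, of n] U elim
      by (intro markov_const_sq_le) (auto simp: U_def N_def)
    then show ?case using elim by (simp add: field_simps)
  qed
  have low: "\<forall>\<^sub>F \<alpha> in at_right (-1::real). V \<alpha> \<le> (\<alpha> + 1) * (markov_const n \<alpha>)\<^sup>2"
    using near
  proof eventually_elim
    case (elim \<alpha>)
    show ?case
    proof (cases "n = 0")
      case True
      then show ?thesis using elim by (simp add: V_def N_def)
    next
      case False
      \<comment> \<open>The coefficients $a_k = k$ give equality in Cauchy-Schwarz; of the derivative only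
        the component along $L_0$ is kept.\<close>
      have "0 < laguerre_h \<alpha> n * (real n)\<^sup>2"
        using laguerre_h_pos[OF elim, of n] False by simp
      also have "\<dots> \<le> norm_form \<alpha> n real"
        unfolding norm_form_def
        by (rule member_le_sum[where f = "\<lambda>k. laguerre_h \<alpha> k * (real k)\<^sup>2"])
          (use laguerre_h_pos[OF elim] in \<open>auto simp: less_imp_le\<close>)
      finally have pos: "norm_form \<alpha> n real > 0" .
      have "(\<Sum>k\<in>{0<..n}. real k) = N"
        unfolding sumN[symmetric] by (intro sum.mono_neutral_left) auto
      then have "laguerre_h \<alpha> 0 * N\<^sup>2 = (\<Sum>j\<in>{0}. laguerre_h \<alpha> j * (\<Sum>k\<in>{j<..n}. real k)\<^sup>2)"
        by simp
      also have "\<dots> \<le> deriv_form \<alpha> n real"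
        unfolding deriv_form_def
        using False laguerre_h_pos[OF elim] by (intro sum_mono2) (auto simp: less_imp_le)
      finally have "laguerre_h \<alpha> 0 * N\<^sup>2 / norm_form \<alpha> n real
          \<le> deriv_form \<alpha> n real / norm_form \<alpha> n real"
        using pos by (intro divide_right_mono) auto
      also have "\<dots> \<le> (markov_const n \<alpha>)\<^sup>2"
        by (rule markov_const_sq_ge(1)[OF elim pos])
      finally have "(\<alpha> + 1) * (laguerre_h \<alpha> 0 * N\<^sup>2 / norm_form \<alpha> n real)
          \<le> (\<alpha> + 1) * (markov_const n \<alpha>)\<^sup>2"
        using elim by (intro mult_left_mono) auto
      moreover have "V \<alpha> = N\<^sup>2 / (norm_form \<alpha> n real / ((\<alpha> + 1) * laguerre_h \<alpha> 0))"
        by (simp add: V_def norm_form_def sum_divide_distrib mult.commute)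
      ultimately show ?thesis by (simp add: mult_ac)
    qed
  qed
  have "(U \<longlongrightarrow> N * (\<Sum>j<n. if j = 0 then 1 else 0)) (at_right (- 1))"
    unfolding U_def by (intro tendsto_mult tendsto_sum laguerre_h_div_at_minus_1 tendsto_const)
  moreover have "N * (\<Sum>j<n. if j = 0 then 1 else 0) = N"
    by (cases "n = 0") (simp_all add: N_def)
  ultimately have U: "(U \<longlongrightarrow> N) (at_right (- 1))" by (simp only:)
  have V: "(V \<longlongrightarrow> N) (at_right (- 1))"
  proof (cases "n = 0")
    case True
    then show ?thesis by (simp add: V_def[abs_def] N_def)
  next
    case False
    then have "N \<noteq> 0" by (simp add: N_def)
    have "((\<lambda>\<alpha>. \<Sum>k\<le>n. (real k)\<^sup>2 * laguerre_h \<alpha> k / ((\<alpha> + 1) * laguerre_h \<alpha> 0))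
        \<longlongrightarrow> N) (at_right (- 1))"
      unfolding sumN[symmetric] by (intro tendsto_sum laguerre_h_ratio_at_minus_1)
    from tendsto_divide[OF tendsto_const this \<open>N \<noteq> 0\<close>, of "N\<^sup>2"] \<open>N \<noteq> 0\<close>
    show ?thesis by (simp add: V_def[abs_def] power2_eq_square)
  qed
  show ?thesis
    unfolding N_def[symmetric] by (rule tendsto_sandwich[OF low up V U])
qed

section \<open>The limit at infinity\<close>

text \<open>
  Shifting a sequence down by one index gains a factor $r$ in the weighted $\ell^2$ norm, because
  $h_j \le r^2 h_{j+1}$. Applied to both summands of $S_j = a_{j+1} + S_{j+1}$, this bounds
  $\|p'\|$ by $r\|p\| + r\|p'\|$, and the second term is absorbed on the left.
\<close>
lemma deriv_form_le_large:
  assumes "\<alpha> > real n"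
  defines "r \<equiv> sqrt (real n / \<alpha>)"
  shows "deriv_form \<alpha> n a \<le> (r / (1 - r))\<^sup>2 * norm_form \<alpha> n a"
proof -
  have \<alpha>: "\<alpha> > 0" "\<alpha> > -1"
    using assms(1) by linarith+
  have r: "0 \<le> r" "r < 1" "r\<^sup>2 = real n / \<alpha>"
    using assms(1) \<alpha> by (simp_all add: r_def)
  define S where "S j = (\<Sum>k\<in>{j<..n}. a k)" for j
  have S: "S j = a (Suc j) + S (Suc j)" if "j < n" for j
  proof -
    have "{j<..n} = insert (Suc j) {Suc j<..n}" using that by auto
    then show ?thesis by (simp add: S_def)
  qed
  have ratio: "laguerre_h \<alpha> j \<le> r\<^sup>2 * laguerre_h \<alpha> (Suc j)" if "j < n" for j
  proof -
    have "(real j + 1) * \<alpha> \<le> real n * (\<alpha> + real j + 1)"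
      using that \<alpha> by (intro mult_mono) auto
    then have "1 \<le> real n / \<alpha> * ((\<alpha> + real j + 1) / (real j + 1))"
      using \<alpha> by (simp add: le_divide_eq mult.commute)
    from mult_left_mono[OF this less_imp_le[OF laguerre_h_pos[OF \<alpha>(2), of j]]]
    show ?thesis
      by (simp add: laguerre_h_Suc[OF \<alpha>(2)] r(3) mult_ac)
  qed
  have shift: "L2_set (\<lambda>j. sqrt (laguerre_h \<alpha> j) * b (Suc j)) {..<n}
      \<le> r * sqrt (\<Sum>j\<le>n. laguerre_h \<alpha> j * (b j)\<^sup>2)"
    for b :: "nat \<Rightarrow> real"
  proof -
    have "(\<Sum>j<n. (sqrt (laguerre_h \<alpha> j) * b (Suc j))\<^sup>2)
        \<le> (\<Sum>j<n. r\<^sup>2 * (laguerre_h \<alpha> (Suc j) * (b (Suc j))\<^sup>2))"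
    proof (intro sum_mono)
      fix j assume "j \<in> {..<n}"
      then have "laguerre_h \<alpha> j * (b (Suc j))\<^sup>2 \<le> r\<^sup>2 * laguerre_h \<alpha> (Suc j) * (b (Suc j))\<^sup>2"
        by (intro mult_right_mono ratio) auto
      then show "(sqrt (laguerre_h \<alpha> j) * b (Suc j))\<^sup>2
          \<le> r\<^sup>2 * (laguerre_h \<alpha> (Suc j) * (b (Suc j))\<^sup>2)"
        using laguerre_h_pos[OF \<alpha>(2), of j] by (simp add: power_mult_distrib mult_ac)
    qed
    also have "\<dots> = r\<^sup>2 * (\<Sum>j<n. laguerre_h \<alpha> (Suc j) * (b (Suc j))\<^sup>2)"
      by (simp add: sum_distrib_left)
    also have "\<dots> \<le> r\<^sup>2 * (\<Sum>j\<le>n. laguerre_h \<alpha> j * (b j)\<^sup>2)"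
      using laguerre_h_pos[OF \<alpha>(2), of 0] by (intro mult_left_mono) (auto simp: sum.atMost_shift)
    finally show ?thesis
      using real_sqrt_le_mono[of _ "r\<^sup>2 * (\<Sum>j\<le>n. laguerre_h \<alpha> j * (b j)\<^sup>2)"] r(1)
      by (simp add: L2_set_def real_sqrt_mult)
  qed
  define D where "D = sqrt (deriv_form \<alpha> n a)"
  define Q where "Q = sqrt (norm_form \<alpha> n a)"
  have D: "D = L2_set (\<lambda>j. sqrt (laguerre_h \<alpha> j) * S j) {..<n}"
    using laguerre_h_pos[OF \<alpha>(2)]
    by (simp add: D_def deriv_form_def S_def L2_set_def power_mult_distrib less_imp_le)
  have "D = L2_set (\<lambda>j. sqrt (laguerre_h \<alpha> j) * a (Suc j)
      + sqrt (laguerre_h \<alpha> j) * S (Suc j)) {..<n}"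
    unfolding D by (intro L2_set_cong) (auto simp: S distrib_left)
  also have "\<dots>
      \<le> L2_set (\<lambda>j. sqrt (laguerre_h \<alpha> j) * a (Suc j)) {..<n}
        + L2_set (\<lambda>j. sqrt (laguerre_h \<alpha> j) * S (Suc j)) {..<n}"
    by (rule L2_set_triangle_ineq)
  also have "\<dots> \<le> r * Q + r * D"
  proof (intro add_mono)
    show "L2_set (\<lambda>j. sqrt (laguerre_h \<alpha> j) * a (Suc j)) {..<n} \<le> r * Q"
      using shift[of a] by (simp add: Q_def norm_form_def)
    \<comment> \<open>The term $j = n$ vanishes, as $S_n$ is an empty sum.\<close>
    have "(\<Sum>j\<le>n. laguerre_h \<alpha> j * (S j)\<^sup>2) = deriv_form \<alpha> n a"
      by (simp add: deriv_form_def S_def flip: lessThan_Suc_atMost)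
    then show "L2_set (\<lambda>j. sqrt (laguerre_h \<alpha> j) * S (Suc j)) {..<n} \<le> r * D"
      using shift[of S] by (simp add: D_def)
  qed
  finally have "D \<le> r / (1 - r) * Q"
    using r by (simp add: field_simps)
  then have "D\<^sup>2 \<le> (r / (1 - r) * Q)\<^sup>2"
    using deriv_form_nonneg[OF \<alpha>(2)] by (intro power_mono) (auto simp: D_def)
  then show ?thesis
    using deriv_form_nonneg[OF \<alpha>(2)] norm_form_nonneg[OF \<alpha>(2)]
    by (simp add: D_def Q_def power_mult_distrib power_divide)
qed

lemma markov_const_at_top:
  "((\<lambda>\<alpha>. \<alpha> * (markov_const n \<alpha>)\<^sup>2) \<longlongrightarrow> real n) at_top"
proof -
  have large: "\<forall>\<^sub>F \<alpha> in at_top. real n < \<alpha>"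
    by (rule eventually_gt_at_top)
  have up: "\<forall>\<^sub>F \<alpha> in at_top. \<alpha> * (markov_const n \<alpha>)\<^sup>2 \<le> real n / (1 - sqrt (real n / \<alpha>))\<^sup>2"
    using large
  proof eventually_elim
    case (elim \<alpha>)
    then have \<alpha>: "\<alpha> > 0" "\<alpha> > -1" by linarith+
    have "(markov_const n \<alpha>)\<^sup>2 \<le> (sqrt (real n / \<alpha>) / (1 - sqrt (real n / \<alpha>)))\<^sup>2"
      using deriv_form_le_large[OF elim] by (intro markov_const_sq_le \<alpha>) auto
    from mult_left_mono[OF this, of \<alpha>] show ?case
      using \<alpha> by (simp add: power_divide)
  qed
  have low: "\<forall>\<^sub>F \<alpha> in at_top. \<alpha> * (real n / (\<alpha> + real n)) \<le> \<alpha> * (markov_const n \<alpha>)\<^sup>2"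
    using large
  proof eventually_elim
    case (elim \<alpha>)
    then have \<alpha>: "\<alpha> > 0" "\<alpha> > -1" by linarith+
    show ?case
    proof (cases n)
      case 0
      then show ?thesis using \<alpha> by simp
    next
      case (Suc m)
      \<comment> \<open>The test polynomial is $L_n$; of its derivative only the component along $L_{n-1}$
        is kept.\<close>
      define a :: "nat \<Rightarrow> real" where "a k = (if k = n then 1 else 0)" for k
      have Q: "norm_form \<alpha> n a = laguerre_h \<alpha> n"
        by (simp add: norm_form_def a_def if_distrib[of "\<lambda>x. x\<^sup>2"] if_distrib[of "\<lambda>x. _ * x"] cong: if_cong)
      have "{m<..n} = {n}" using Suc by auto
      then have "laguerre_h \<alpha> m = (\<Sum>j\<in>{m}. laguerre_h \<alpha> j * (\<Sum>k\<in>{j<..n}. a k)\<^sup>2)"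
        by (simp add: a_def)
      also have "\<dots> \<le> deriv_form \<alpha> n a"
        unfolding deriv_form_def
        using Suc laguerre_h_pos[OF \<alpha>(2)] by (intro sum_mono2) (auto simp: less_imp_le)
      finally have "laguerre_h \<alpha> m / laguerre_h \<alpha> n \<le> deriv_form \<alpha> n a / norm_form \<alpha> n a"
        unfolding Q using laguerre_h_pos[OF \<alpha>(2)]
          by (intro divide_right_mono) (auto simp: less_imp_le)
      also have "\<dots> \<le> (markov_const n \<alpha>)\<^sup>2"
        using laguerre_h_pos[OF \<alpha>(2), of n] Q by (intro markov_const_sq_ge(1) \<alpha>) simp
      also have "laguerre_h \<alpha> m / laguerre_h \<alpha> n = real n / (\<alpha> + real n)"
        using laguerre_h_pos[OF \<alpha>(2), of m] by (simp add: Suc laguerre_h_Suc[OF \<alpha>(2)] add_ac)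
      finally show ?thesis using \<alpha> by (intro mult_left_mono) auto
    qed
  qed
  have "((\<lambda>\<alpha>. real n / (1 - sqrt (real n / \<alpha>))\<^sup>2) \<longlongrightarrow> real n / (1 - sqrt 0)\<^sup>2) at_top"
    by (intro tendsto_intros tendsto_divide_0[OF tendsto_const] filterlim_at_top_imp_at_infinity
        filterlim_ident) auto
  then have U: "((\<lambda>\<alpha>. real n / (1 - sqrt (real n / \<alpha>))\<^sup>2) \<longlongrightarrow> real n) at_top" by simp
  have "((\<lambda>\<alpha>. real n * (1 - real n / (\<alpha> + real n))) \<longlongrightarrow> real n * (1 - 0)) at_top"
    by (intro tendsto_intros tendsto_divide_0[OF tendsto_const] filterlim_at_top_imp_at_infinity
        filterlim_tendsto_add_at_top[OF tendsto_const filterlim_ident, of "real n", simplified add.commute])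
  moreover have "\<forall>\<^sub>F \<alpha> in at_top. real n * (1 - real n / (\<alpha> + real n))
      = \<alpha> * (real n / (\<alpha> + real n))"
    using large by eventually_elim (simp add: field_simps)
  ultimately have V: "((\<lambda>\<alpha>. \<alpha> * (real n / (\<alpha> + real n))) \<longlongrightarrow> real n) at_top"
    using Lim_transform_eventually by fastforce
  show ?thesis
    by (rule tendsto_sandwich[OF low up V U])
qed

theorem corollary1p3:
  fixes n :: nat
  shows "((\<lambda>\<alpha>::real. (\<alpha> + 1) * (markov_const n \<alpha>)\<^sup>2) \<longlongrightarrow> real n * (real n + 1) / 2) (at_right (- 1))
    \<and> (\<exists>L::real. ((\<lambda>\<alpha>::real. \<alpha> * (markov_const n \<alpha>)\<^sup>2) \<longlongrightarrow> L) at_top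
           \<and> 2 * real n / 3 \<le> L \<and> L \<le> 3 * (real n + 1))"
  using markov_const_at_minus_1[of n] markov_const_at_top[of n]
  by (intro conjI exI[of _ "real n"]) auto

end
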